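(* Assume that the penalization parameter $\gamma$ satisfies $\gamma>2C_I$ and that the mesh parameter $h_\Gamma$ satisfies $h_\Gamma^{\zeta}\le \frac{1}{4c_dC_I}$. Then there exists a constant $\alpha>0$, independent of the meshsize, such that $$a_h(v_h,v_h)\ \ge\ \alpha\,\|v_h\|_a^2\qquad \forall v_h\in V_h ,$$ where $$\|v\|_a^2:=\|\nabla v\|_{0,\tilde\Omega_h}^2+\|h^{-1/2}S_hv\|_{0,\tilde\Gamma_h}^2 .$$
   Context: Let $n\in\{2,3\}$ and let $\Omega\subset\mathbb{R}^n$ be a bounded connected open set with Lipschitz boundary $\Gamma=\partial\Omega$, formed by $C^2$ curves ($n=2$) or surfaces ($n=3$) intersecting at a finite number of vertices ($n=2$) or edges ($n=3$); $\mathrm{diam}(\Omega)\simeq1$. Let $\mathcal D\supseteq\overline\Omega$ be a closed domain and let $\mathcal T_h$ be a family of admissible, shape-regular triangulations of $\mathcal D$. Put $\tilde{\mathcal T}_h:=\{T\in\mathcal T_h: T\subset\overline\Omega\}$, $\tilde\Omega_h:=\mathrm{int}\big(\bigcup_{T\in\tilde{\mathcal T}_h}T\big)\subseteq\Omega$ (surrogate domain), $\tilde\Gamma_h:=\partial\tilde\Omega_h$ (surrogate boundary), with outward unit normal $\tilde{\boldsymbol n}$, and $\partial_{\tilde n}:=\tilde{\boldsymbol n}\cdot\nabla$. $h_T$ is the diameter of $T$, and $h$ is the piecewise constant function with $h_{|T}=h_T$. Set $h_\Gamma:=\max\{h_T: T\in\tilde{\mathcal T}_h,\ T\cap\tilde\Gamma_h\neq\emptyset\}$.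 $(\cdot,\cdot)_{0,D}$ and $\|\cdot\|_{0,D}$ are the $L^2(D)$ inner product and norm. $\boldsymbol M_h:\tilde\Gamma_h\to\Gamma$ is a given mapping (such that the integrals below make sense), $\boldsymbol d(\tilde{\boldsymbol x}):=\boldsymbol M_h(\tilde{\boldsymbol x})-\tilde{\boldsymbol x}$ for $\tilde{\boldsymbol x}\in\tilde\Gamma_h$, and $S_hv:=v+\nabla v\cdot\boldsymbol d$ on $\tilde\Gamma_h$. Standing assumption: there are constants $c_d>0$ and $\zeta>0$ (independent of the mesh) such that $\|\boldsymbol d(\tilde{\boldsymbol x})\|\le c_d\,h_T^{1+\zeta}$ for all $\tilde{\boldsymbol x}\in T\cap\tilde\Gamma_h$ and all $T\in\tilde{\mathcal T}_h$. $V_h:=\{v\in H^1(\tilde\Omega_h): v_{|T}\in\mathbb P_1(T)\ \forall T\in\tilde{\mathcal T}_h\}$. For a parameter $\gamma>0$, $$a_h(w,v):=(\nabla w,\nabla v)_{0,\tilde\Omega_h}-(\partial_{\tilde n}w,v)_{0,\tilde\Gamma_h}-(S_hw,\partial_{\tilde n}v)_{0,\tilde\Gamma_h}+\gamma\,(h^{-1}S_hw,S_hv)_{0,\tilde\Gamma_h}.$$ $C_I>0$ denotes a constant, independent of the meshsize, for which the scaled trace inequalities hold: $\|h_T^{1/2}\nabla w\|_{0,E}^2\le C_I\|\nabla w\|_{0,T}^2$ for all $T\in\tilde{\mathcal T}_h$, all edges/faces $E\subset\partial T$ and all $w\in\mathbb P_1(T)$, and $\|h^{1/2}\nabla w\|_{0,\tilde\Gamma_h}^2\le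 C_I\|\nabla w\|_{0,\tilde\Omega_h}^2$ for all $w\in V_h$. *)

theory Defs
  imports "HOL-Analysis.Analysis"
begin
text \<open>Boundedness of the covering sets is required explicitly because \<^const>\<open>diameter\<close> of an
  unbounded set is unspecified.  Normalised so that, for \<open>k = CARD('n)\<close> on \<open>real ^ 'n\<close>, it is
  Lebesgue measure.  Only meant for \<open>k \<ge> 1\<close>.\<close>

definition hausdorff_outer :: "nat \<Rightarrow> 'a::metric_space set \<Rightarrow> ennreal" where
  "hausdorff_outer k A =
     (SUP \<delta>\<in>{0<..}. INF U\<in>{U :: nat \<Rightarrow> 'a set. A \<subseteq> (\<Union>i. U i) \<and>
                            (\<forall>i. bounded (U i) \<and> diameter (U i) \<le> \<delta>)}.
        \<Sum>i. ennreal (unit_ball_vol (real k) / 2 ^ k * diameter (U i) ^ k))"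

definition hausdorff_measure :: "nat \<Rightarrow> 'a::metric_space measure" where
  "hausdorff_measure k = completion (measure_of UNIV (sets borel) (hausdorff_outer k))"

definition surface_measure :: "(real ^ 'n) measure" where
  "surface_measure = hausdorff_measure (CARD('n) - 1)"

definition L2_inner :: "'a measure \<Rightarrow> 'a set \<Rightarrow> ('a \<Rightarrow> 'b::real_inner) \<Rightarrow> ('a \<Rightarrow> 'b) \<Rightarrow> real" where
  "L2_inner M A f g = (LINT x:A|M. f x \<bullet> g x)"

definition L2_norm :: "'a measure \<Rightarrow> 'a set \<Rightarrow> ('a \<Rightarrow> 'b::real_inner) \<Rightarrow> real" where
  "L2_norm M A f = sqrt (L2_inner M A f f)"

definition L2 :: "(real ^ 'n) set \<Rightarrow> (real ^ 'n \<Rightarrow> 'b::euclidean_space) \<Rightarrow> bool" where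
  "L2 U f \<longleftrightarrow> set_borel_measurable lebesgue U f \<and> set_integrable lebesgue U (\<lambda>x. (norm (f x))\<^sup>2)"

definition grad :: "(real ^ 'n \<Rightarrow> real) \<Rightarrow> real ^ 'n \<Rightarrow> real ^ 'n" where
  "grad f x = (THE D. GDERIV f x :> D)"

text \<open>\<open>C\<^sup>k\<close> functions; only meant for open \<open>U\<close>, as \<^const>\<open>grad\<close> is unrestricted.\<close>

primrec Ck_on :: "nat \<Rightarrow> (real ^ 'n) set \<Rightarrow> (real ^ 'n \<Rightarrow> real) \<Rightarrow> bool" where
  "Ck_on 0 U f = continuous_on U f"
| "Ck_on (Suc k) U f = ((\<forall>x\<in>U. f differentiable (at x)) \<and> (\<forall>i. Ck_on k U (\<lambda>x. grad f x $ i)))"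

definition test_fun :: "(real ^ 'n) set \<Rightarrow> (real ^ 'n \<Rightarrow> real) \<Rightarrow> bool" where
  "test_fun U \<phi> \<longleftrightarrow> (\<forall>k. Ck_on k UNIV \<phi>) \<and> compact (closure {x. \<phi> x \<noteq> 0}) \<and> closure {x. \<phi> x \<noteq> 0} \<subseteq> U"

definition is_weak_grad :: "(real ^ 'n) set \<Rightarrow> (real ^ 'n \<Rightarrow> real) \<Rightarrow> (real ^ 'n \<Rightarrow> real ^ 'n) \<Rightarrow> bool" where
  "is_weak_grad U v g \<longleftrightarrow>
     (\<forall>\<phi> i. test_fun U \<phi> \<longrightarrow> (LINT x:U|lebesgue. v x * grad \<phi> x $ i) = - (LINT x:U|lebesgue. g x $ i * \<phi> x))"

definition H1 :: "(real ^ 'n) set \<Rightarrow> (real ^ 'n \<Rightarrow> real) set" where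
  "H1 U = {v. L2 U v \<and> (\<exists>g. L2 U g \<and> is_weak_grad U v g)}"

definition wgrad :: "(real ^ 'n) set \<Rightarrow> (real ^ 'n \<Rightarrow> real) \<Rightarrow> real ^ 'n \<Rightarrow> real ^ 'n" where
  "wgrad U v = (SOME g. L2 U g \<and> is_weak_grad U v g)"

text \<open>Near each boundary point the set is, in suitable Cartesian coordinates with last axis \<open>e\<close>,
  the region below the graph of a Lipschitz function on the hyperplane orthogonal to \<open>e\<close>.\<close>

definition lipschitz_boundary :: "(real ^ 'n) set \<Rightarrow> bool" where
  "lipschitz_boundary U \<longleftrightarrow>
     (\<forall>x\<in>frontier U. \<exists>e r L g. norm e = 1 \<and> r > 0 \<and> L-lipschitz_on {z. z \<bullet> e = 0} g \<and>
        (\<forall>y\<in>ball x r. y \<in> U \<longleftrightarrow> y \<bullet> e < g (y - (y \<bullet> e) *\<^sub>R e)))"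

text \<open>Embedded \<open>C\<^sup>2\<close> submanifolds of codimension one: curves in the plane, surfaces in space.\<close>

definition C2_hypersurface :: "(real ^ 'n) set \<Rightarrow> bool" where
  "C2_hypersurface M \<longleftrightarrow>
     (\<forall>x\<in>M. \<exists>U \<phi>. open U \<and> x \<in> U \<and> Ck_on 2 U \<phi> \<and> (\<forall>y\<in>U. grad \<phi> y \<noteq> 0) \<and>
        M \<inter> U = {y \<in> U. \<phi> y = 0})"

text \<open>The pieces are compact parts of \<open>C\<^sup>2\<close> curves/surfaces; the set where different pieces meet
  consists of finitely many vertices (dimension 2) or of finitely many edges (dimension 3).\<close>

definition piecewise_C2 :: "(real ^ 'n) set \<Rightarrow> bool" where
  "piecewise_C2 \<Gamma> \<longleftrightarrow>
     (\<exists>\<G>. finite \<G> \<and> \<Union>\<G> = \<Gamma> \<and>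
        (\<forall>G\<in>\<G>. compact G \<and> connected G \<and> (\<exists>M. C2_hypersurface M \<and> G \<subseteq> M)) \<and>
        (let S = \<Union>{G \<inter> G' | G G'. G \<in> \<G> \<and> G' \<in> \<G> \<and> G \<noteq> G'} in
           (CARD('n) = 2 \<longrightarrow> finite S) \<and>
           (CARD('n) = 3 \<longrightarrow>
              (\<exists>\<E>. finite \<E> \<and> \<Union>\<E> = S \<and> (\<forall>E\<in>\<E>. \<exists>p. simple_path p \<and> E = path_image p)))))"

definition mesh_of :: "(real ^ 'n) set set \<Rightarrow> (real ^ 'n) set \<Rightarrow> bool" where
  "mesh_of \<T> D \<longleftrightarrow> triangulation \<T> \<and> (\<forall>T\<in>\<T>. int CARD('n) simplex T) \<and> \<Union>\<T> = D"

definition incircle_diam :: "(real ^ 'n) set \<Rightarrow> real" where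
  "incircle_diam T = 2 * Sup {r. 0 \<le> r \<and> (\<exists>c. cball c r \<subseteq> T)}"

definition shape_regular :: "('h \<Rightarrow> (real ^ 'n) set set) \<Rightarrow> bool" where
  "shape_regular \<T> \<longleftrightarrow> (\<exists>\<kappa>. \<forall>h. \<forall>T\<in>\<T> h. diameter T \<le> \<kappa> * incircle_diam T)"

definition inner_elems :: "(real ^ 'n) set \<Rightarrow> (real ^ 'n) set set \<Rightarrow> (real ^ 'n) set set" where
  "inner_elems \<Omega> \<T> = {T \<in> \<T>. T \<subseteq> closure \<Omega>}"

text \<open>In the following, \<open>\<S>\<close> is the set of elements that make up the surrogate domain.\<close>

definition surr_dom :: "(real ^ 'n) set set \<Rightarrow> (real ^ 'n) set" where
  "surr_dom \<S> = interior (\<Union>\<S>)"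

definition surr_bd :: "(real ^ 'n) set set \<Rightarrow> (real ^ 'n) set" where
  "surr_bd \<S> = frontier (surr_dom \<S>)"

definition h_bd :: "(real ^ 'n) set set \<Rightarrow> real" where
  "h_bd \<S> = Max (diameter ` {T \<in> \<S>. T \<inter> surr_bd \<S> \<noteq> {}})"

text \<open>A point of the surrogate boundary lies in exactly one element, except for points on faces
  of codimension at least two; these form a null set for the surface measure.\<close>

definition elem_at :: "(real ^ 'n) set set \<Rightarrow> real ^ 'n \<Rightarrow> (real ^ 'n) set" where
  "elem_at \<S> x = (SOME T. T \<in> \<S> \<and> x \<in> T)"

definition h_at :: "(real ^ 'n) set set \<Rightarrow> real ^ 'n \<Rightarrow> real" where
  "h_at \<S> x = diameter (elem_at \<S> x)"

text \<open>Outward unit normal of a polyhedral open set \<open>U\<close>: near a point in the relative interior of a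
  flat boundary face, \<open>U\<close> is an open half space.  The other boundary points form a null set.\<close>

definition is_flat_normal :: "(real ^ 'n) set \<Rightarrow> real ^ 'n \<Rightarrow> real ^ 'n \<Rightarrow> bool" where
  "is_flat_normal U x \<nu> \<longleftrightarrow> norm \<nu> = 1 \<and> (\<exists>r>0. \<forall>y\<in>ball x r. y \<in> U \<longleftrightarrow> (y - x) \<bullet> \<nu> < 0)"

definition outward_normal :: "(real ^ 'n) set \<Rightarrow> real ^ 'n \<Rightarrow> real ^ 'n" where
  "outward_normal U x =
     (if \<exists>\<nu>. is_flat_normal U x \<nu> then THE \<nu>. is_flat_normal U x \<nu> else 0)"

definition P1 :: "(real ^ 'n \<Rightarrow> real) set" where
  "P1 = {p. \<exists>a b. p = (\<lambda>x. a + b \<bullet> x)}"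

text \<open>The restriction to \<open>T\<close> is compared on the interior only.  \<open>H\<^sup>1\<close> functions are equivalence
  classes, and two elements of the surrogate domain may touch at a point (or edge) across which
  an \<open>H\<^sup>1\<close> function need not be continuous.  Traces on the boundary are taken from inside the
  element, i.e. as values of the polynomial \<open>piece T v\<close>.\<close>

definition V :: "(real ^ 'n) set set \<Rightarrow> (real ^ 'n \<Rightarrow> real) set" where
  "V \<S> = {v \<in> H1 (surr_dom \<S>). \<forall>T\<in>\<S>. \<exists>p\<in>P1. \<forall>x\<in>interior T. v x = p x}"

definition piece :: "(real ^ 'n) set \<Rightarrow> (real ^ 'n \<Rightarrow> real) \<Rightarrow> real ^ 'n \<Rightarrow> real" where
  "piece T v = (THE p. p \<in> P1 \<and> (\<forall>x\<in>interior T. v x = p x))"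

definition tr :: "(real ^ 'n) set set \<Rightarrow> (real ^ 'n \<Rightarrow> real) \<Rightarrow> real ^ 'n \<Rightarrow> real" where
  "tr \<S> v x = piece (elem_at \<S> x) v x"

definition tr_grad :: "(real ^ 'n) set set \<Rightarrow> (real ^ 'n \<Rightarrow> real) \<Rightarrow> real ^ 'n \<Rightarrow> real ^ 'n" where
  "tr_grad \<S> v x = grad (piece (elem_at \<S> x) v) x"

definition normal_deriv :: "(real ^ 'n) set set \<Rightarrow> (real ^ 'n \<Rightarrow> real) \<Rightarrow> real ^ 'n \<Rightarrow> real" where
  "normal_deriv \<S> v x = outward_normal (surr_dom \<S>) x \<bullet> tr_grad \<S> v x"

definition dist_vec :: "(real ^ 'n \<Rightarrow> real ^ 'n) \<Rightarrow> real ^ 'n \<Rightarrow> real ^ 'n" where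
  "dist_vec M x = M x - x"

definition shift ::
  "(real ^ 'n) set set \<Rightarrow> (real ^ 'n \<Rightarrow> real ^ 'n) \<Rightarrow> (real ^ 'n \<Rightarrow> real) \<Rightarrow> real ^ 'n \<Rightarrow> real" where
  "shift \<S> M v x = tr \<S> v x + tr_grad \<S> v x \<bullet> dist_vec M x"

definition a_form ::
  "(real ^ 'n) set set \<Rightarrow> (real ^ 'n \<Rightarrow> real ^ 'n) \<Rightarrow> real \<Rightarrow>
    (real ^ 'n \<Rightarrow> real) \<Rightarrow> (real ^ 'n \<Rightarrow> real) \<Rightarrow> real" where
  "a_form \<S> M \<gamma> w v =
     L2_inner lebesgue (surr_dom \<S>) (wgrad (surr_dom \<S>) w) (wgrad (surr_dom \<S>) v)
     - L2_inner surface_measure (surr_bd \<S>) (normal_deriv \<S> w) (tr \<S> v)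
     - L2_inner surface_measure (surr_bd \<S>) (shift \<S> M w) (normal_deriv \<S> v)
     + \<gamma> * L2_inner surface_measure (surr_bd \<S>)
             (\<lambda>x. inverse (h_at \<S> x) * shift \<S> M w x) (shift \<S> M v)"

definition a_norm ::
  "(real ^ 'n) set set \<Rightarrow> (real ^ 'n \<Rightarrow> real ^ 'n) \<Rightarrow> (real ^ 'n \<Rightarrow> real) \<Rightarrow> real" where
  "a_norm \<S> M v =
     sqrt ((L2_norm lebesgue (surr_dom \<S>) (wgrad (surr_dom \<S>) v))\<^sup>2 +
           (L2_norm surface_measure (surr_bd \<S>) (\<lambda>x. h_at \<S> x powr (- 1 / 2) * shift \<S> M v x))\<^sup>2)"

definition elem_trace_ineq :: "real \<Rightarrow> (real ^ 'n) set \<Rightarrow> bool" where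
  "elem_trace_ineq C T \<longleftrightarrow>
     (\<forall>E w. E facet_of T \<and> w \<in> P1 \<longrightarrow>
        (L2_norm surface_measure E (\<lambda>x. diameter T powr (1 / 2) *\<^sub>R grad w x))\<^sup>2
          \<le> C * (L2_norm lebesgue T (grad w))\<^sup>2)"

definition mesh_trace_ineq :: "real \<Rightarrow> (real ^ 'n) set set \<Rightarrow> bool" where
  "mesh_trace_ineq C \<S> \<longleftrightarrow>
     (\<forall>w\<in>V \<S>. (L2_norm surface_measure (surr_bd \<S>) (\<lambda>x. h_at \<S> x powr (1 / 2) *\<^sub>R tr_grad \<S> w x))\<^sup>2
          \<le> C * (L2_norm lebesgue (surr_dom \<S>) (wgrad (surr_dom \<S>) w))\<^sup>2)"

end

theory Submission
  imports Defs
begin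

text \<open>On the surrogate boundary \<open>v = S\<^sub>h v - \<nabla>v \<bullet> d\<close>, so with \<open>\<nu>\<close> the outward normal
  \<open>a\<^sub>h(v,v) = |\<nabla>v|\<^sup>2 - 2 (S\<^sub>h v, \<nu> \<bullet> \<nabla>v) + (\<nu> \<bullet> \<nabla>v, \<nabla>v \<bullet> d) + \<gamma> (h\<^sup>-\<^sup>1 S\<^sub>h v, S\<^sub>h v)\<close>, where the first
  term is a volume norm and the others are integrals over the boundary.
  Young's inequality with weight \<open>2 C\<^sub>I\<close> bounds the second term by
  \<open>2 C\<^sub>I h\<^sup>-\<^sup>1 (S\<^sub>h v)\<^sup>2 + h |\<nabla>v|\<^sup>2 / (2 C\<^sub>I)\<close>, and the smallness of \<open>h\<^sub>\<Gamma>\<close> gives \<open>|d| \<le> h / (4 C\<^sub>I)\<close>, hence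
  bounds the third by \<open>h |\<nabla>v|\<^sup>2 / (4 C\<^sub>I)\<close>.  Both bounds hold pointwise
  (\<open>boundary_integrand_lower_bound\<close>).  Once integrated, the gradient terms cost, by the trace
  inequality, three quarters of the volume term, which leaves
  \<open>\<alpha> = min (1/4) (\<gamma> - 2 C\<^sub>I)\<close> (\<open>a_form_coercive\<close>).

  Splitting and comparing the boundary integrals is legitimate only for integrable functions; the
  Bochner integral of any other function is \<open>0\<close>, which would break the estimate.  Two facts secure
  integrability.  First, the surrogate boundary lies in finitely many facets, and a bounded part of a
  hyperplane has finite Hausdorff outer measure (\<open>hausdorff_outer_bounded_hyperplane\<close>).  Second,
  every boundary quantity is bounded and measurable: traces, gradients and the local mesh size are
  chosen element by element among finitely many affine functions
  (\<open>bounded_measurable_elementwise\<close>), and the normal is locally constant where it is defined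
  (\<open>flat_normal_nearby\<close>).\<close>

section \<open>The surface measure of a polyhedral boundary is finite\<close>

lemma hausdorff_outer_le_of_finite_covers:
  fixes A :: "'a::metric_space set" and B :: real
  assumes "1 \<le> k"
    and cover: "\<And>\<delta>. 0 < \<delta> \<Longrightarrow> \<exists>(P :: 'p set) C d. finite P \<and> A \<subseteq> (\<Union>p\<in>P. C p) \<and> 0 \<le> d \<and> d \<le> \<delta> \<and>
                  (\<forall>p\<in>P. bounded (C p) \<and> diameter (C p) \<le> d) \<and> real (card P) * d ^ k \<le> B"
  shows "hausdorff_outer k A \<le> ennreal (unit_ball_vol (real k) / 2 ^ k * B)"
  unfolding hausdorff_outer_def
proof (rule SUP_least)
  fix \<delta> :: real assume "\<delta> \<in> {0<..}"
  then obtain P :: "'p set" and C d where P: "finite P" "A \<subseteq> (\<Union>p\<in>P. C p)" "0 \<le> d" "d \<le> \<delta>"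
    and C: "\<And>p. p \<in> P \<Longrightarrow> bounded (C p)" "\<And>p. p \<in> P \<Longrightarrow> diameter (C p) \<le> d"
    and B: "real (card P) * d ^ k \<le> B"
    using cover[of \<delta>] by auto
  obtain e where e: "bij_betw e {0..<card P} P"
    using ex_bij_betw_nat_finite[OF P(1)] by blast
  have eP: "e i \<in> P" if "i < card P" for i
    using e that by (auto simp: bij_betw_def)
  \<comment> \<open>The coverings in the definition are sequences, so the finite family is continued by empty
    sets; these cost nothing because \<open>k \<ge> 1\<close>.\<close>
  define U where "U = (\<lambda>i. if i < card P then C (e i) else {})"
  define c where "c = unit_ball_vol (real k) / 2 ^ k"
  have c0: "0 \<le> c"
    by (simp add: c_def)
  have dU: "diameter (U i) \<le> d \<and> bounded (U i)" for i
    using C eP P(3) by (auto simp: U_def)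
  have "A \<subseteq> (\<Union>i. U i)"
  proof
    fix x assume "x \<in> A"
    then obtain p where p: "p \<in> P" "x \<in> C p" using P(2) by auto
    then obtain i where "i < card P" "e i = p"
      using e by (metis atLeastLessThan_iff bij_betw_def imageE)
    then have "x \<in> U i" using p by (simp add: U_def)
    then show "x \<in> (\<Union>i. U i)" by blast
  qed
  then have mem: "U \<in> {U. A \<subseteq> (\<Union>i. U i) \<and> (\<forall>i. bounded (U i) \<and> diameter (U i) \<le> \<delta>)}"
    using dU P(4) order_trans by blast
  have "(\<Sum>i. ennreal (c * diameter (U i) ^ k)) = (\<Sum>i<card P. ennreal (c * diameter (U i) ^ k))"
    using \<open>1 \<le> k\<close> by (intro suminf_finite) (auto simp: U_def zero_power)
  also have "\<dots> \<le> (\<Sum>i<card P. ennreal (c * d ^ k))"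
    using dU c0 by (intro sum_mono ennreal_leI mult_left_mono power_mono) (auto simp: diameter_ge_0)
  also have "\<dots> = ennreal (c * (real (card P) * d ^ k))"
    using c0 P(3) by (subst sum_ennreal) (auto simp: mult.left_commute)
  also have "\<dots> \<le> ennreal (c * B)"
    using B c0 by (intro ennreal_leI mult_left_mono)
  finally show "(INF U\<in>{U. A \<subseteq> (\<Union>i. U i) \<and> (\<forall>i. bounded (U i) \<and> diameter (U i) \<le> \<delta>)}.
        \<Sum>i. ennreal (unit_ball_vol (real k) / 2 ^ k * diameter (U i) ^ k))
      \<le> ennreal (unit_ball_vol (real k) / 2 ^ k * B)"
    using mem unfolding c_def by (intro INF_lower2)
qed

text \<open>A coordinate of the normal of maximal modulus can be solved for, so the hyperplane is a graph
  over the other \<open>k = n - 1\<close> coordinates.  Hence two points whose remaining coordinates lie in the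
  same cube of side \<open>s\<close> are at distance at most \<open>2 k s\<close>, and a bounded piece of the hyperplane is
  covered by \<open>O(s\<^sup>-\<^sup>k)\<close> sets of diameter \<open>O(s)\<close>.\<close>

lemma hausdorff_outer_bounded_hyperplane:
  fixes A :: "(real ^ 'n) set"
  assumes n: "2 \<le> CARD('n)" and bA: "bounded A" and a0: "a \<noteq> 0" and A: "A \<subseteq> {x. a \<bullet> x = b}"
  shows "hausdorff_outer (CARD('n) - 1) A < \<infinity>"
proof -
  define k where "k = CARD('n) - 1"
  have k: "1 \<le> k" using n by (simp add: k_def)
  obtain i where i: "\<And>j. \<bar>a $ j\<bar> \<le> \<bar>a $ i\<bar>"
  proof -
    have "Max (range (\<lambda>j. \<bar>a $ j\<bar>)) \<in> range (\<lambda>j. \<bar>a $ j\<bar>)"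
      by (intro Max_in) auto
    then obtain i where "Max (range (\<lambda>j. \<bar>a $ j\<bar>)) = \<bar>a $ i\<bar>" by (rule rangeE)
    then show ?thesis using that[of i] by (metis Max_ge finite rangeI finite_imageI)
  qed
  have ai: "0 < \<bar>a $ i\<bar>"
  proof (rule ccontr)
    assume "\<not> 0 < \<bar>a $ i\<bar>"
    then have "a $ j = 0" for j using i[of j] by auto
    then show False using a0 by (simp add: vec_eq_iff)
  qed
  \<comment> \<open>The coordinates that parametrise the hyperplane.\<close>
  define I where "I = UNIV - {i}"
  have cI: "card I = k" by (simp add: I_def k_def)
  have norm_le: "norm (x - y) \<le> 2 * (\<Sum>j\<in>I. \<bar>x $ j - y $ j\<bar>)" if "x \<in> A" "y \<in> A" for x y
  proof -
    have "a \<bullet> (x - y) = 0" using that A by (auto simp: inner_diff_right)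
    then have "0 = a $ i * (x $ i - y $ i) + (\<Sum>j\<in>I. a $ j * (x $ j - y $ j))"
      by (simp add: inner_vec_def I_def sum.remove[of UNIV i])
    then have "\<bar>a $ i * (x $ i - y $ i)\<bar> = \<bar>\<Sum>j\<in>I. a $ j * (x $ j - y $ j)\<bar>"
      by linarith
    also have "\<dots> \<le> (\<Sum>j\<in>I. \<bar>a $ j * (x $ j - y $ j)\<bar>)" by (rule sum_abs)
    also have "\<dots> \<le> (\<Sum>j\<in>I. \<bar>a $ i\<bar> * \<bar>x $ j - y $ j\<bar>)"
      using i by (intro sum_mono) (auto simp: abs_mult intro: mult_right_mono)
    finally have "\<bar>a $ i\<bar> * \<bar>x $ i - y $ i\<bar> \<le> \<bar>a $ i\<bar> * (\<Sum>j\<in>I. \<bar>x $ j - y $ j\<bar>)"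
      by (simp add: abs_mult sum_distrib_left)
    then have 1: "\<bar>x $ i - y $ i\<bar> \<le> (\<Sum>j\<in>I. \<bar>x $ j - y $ j\<bar>)" using ai by simp
    have "norm (x - y) \<le> (\<Sum>j\<in>UNIV. \<bar>(x - y) $ j\<bar>)" by (rule norm_le_l1_cart)
    also have "\<dots> = \<bar>x $ i - y $ i\<bar> + (\<Sum>j\<in>I. \<bar>x $ j - y $ j\<bar>)"
      by (simp add: I_def sum.remove[of UNIV i])
    finally show ?thesis using 1 by simp
  qed
  obtain R where R: "0 < R" "\<And>x. x \<in> A \<Longrightarrow> norm x \<le> R"
    using bA bounded_pos by blast
  have "hausdorff_outer k A \<le> ennreal (unit_ball_vol (real k) / 2 ^ k * (6 * k * R) ^ k)"
  proof (rule hausdorff_outer_le_of_finite_covers[OF k])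
    fix \<delta> :: real assume \<delta>: "0 < \<delta>"
    \<comment> \<open>With \<open>m\<close> cubes of side \<open>R / m\<close> per radius \<open>R\<close>, this bound on \<open>m\<close> says \<open>2 k s \<le> \<delta>\<close>.\<close>
    obtain m :: nat where m: "2 * k * R / \<delta> < m" using reals_Archimedean2 by blast
    have "0 < 2 * k * R / \<delta>" using k R \<delta> by simp
    then have m0: "0 < real m" using m by linarith
    define s where "s = R / m"
    have s0: "0 < s" using R m0 by (simp add: s_def)
    define P :: "('n \<Rightarrow> int) set" where "P = (\<Pi>\<^sub>E j\<in>I. {- int m..int m})"
    define C where "C f = {x\<in>A. \<forall>j\<in>I. \<lfloor>x $ j / s\<rfloor> = f j}" for f :: "'n \<Rightarrow> int"
    define d where "d = 2 * k * s"
    have finP: "finite P" by (auto simp: P_def intro!: finite_PiE)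
    have "A \<subseteq> (\<Union>f\<in>P. C f)"
    proof
      fix x assume x: "x \<in> A"
      have "\<lfloor>x $ j / s\<rfloor> \<in> {- int m..int m}" for j
      proof -
        have "\<bar>x $ j\<bar> \<le> s * m"
          using component_le_norm_cart[of x j] R(2)[OF x] m0 by (simp add: s_def)
        then have "x $ j / s \<le> m" "- real m \<le> x $ j / s"
          using s0 by (auto simp: field_simps abs_le_iff)
        then show ?thesis by (simp add: floor_le_iff le_floor_iff)
      qed
      then have "restrict (\<lambda>j. \<lfloor>x $ j / s\<rfloor>) I \<in> P" by (auto simp: P_def)
      moreover have "x \<in> C (restrict (\<lambda>j. \<lfloor>x $ j / s\<rfloor>) I)" using x by (simp add: C_def)
      ultimately show "x \<in> (\<Union>f\<in>P. C f)" by blast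
    qed
    moreover have "bounded (C f) \<and> diameter (C f) \<le> d" for f
    proof
      show "bounded (C f)" using bA by (rule bounded_subset) (auto simp: C_def)
      show "diameter (C f) \<le> d"
      proof (rule diameter_le)
        show "C f \<noteq> {} \<or> 0 \<le> d" using s0 by (simp add: d_def)
        fix x y assume xy: "x \<in> C f" "y \<in> C f"
        have "\<bar>x $ j - y $ j\<bar> \<le> s" if "j \<in> I" for j
        proof -
          have "\<lfloor>x $ j / s\<rfloor> = \<lfloor>y $ j / s\<rfloor>" using xy that by (simp add: C_def)
          then have "\<bar>x $ j / s - y $ j / s\<bar> < 1" by linarith
          then have "\<bar>x $ j - y $ j\<bar> / s < 1" using s0 by (simp flip: diff_divide_distrib)
          then show ?thesis using s0 by simp
        qed
        then have "(\<Sum>j\<in>I. \<bar>x $ j - y $ j\<bar>) \<le> k * s"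
          using sum_bounded_above[of I "\<lambda>j. \<bar>x $ j - y $ j\<bar>" s] cI by simp
        then show "norm (x - y) \<le> d"
          using norm_le[of x y] xy by (auto simp: C_def d_def)
      qed
    qed
    moreover have "d \<le> \<delta>"
      using m m0 \<delta> by (simp add: d_def s_def field_simps)
    moreover have "real (card P) * d ^ k \<le> (6 * k * R) ^ k"
    proof -
      have "card P = (2 * m + 1) ^ k"
        by (simp add: P_def card_PiE cI I_def[symmetric]) (simp add: nat_add_distrib nat_mult_distrib)
      then have "real (card P) * d ^ k = ((2 * m + 1) * d) ^ k"
        by (simp add: power_mult_distrib)
      also have "\<dots> \<le> (3 * m * d) ^ k"
        using m0 s0 by (intro power_mono mult_right_mono) (auto simp: d_def)
      also have "3 * m * d = 6 * k * R" using m0 by (simp add: d_def s_def)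
      finally show ?thesis .
    qed
    moreover have "0 \<le> d" using s0 by (simp add: d_def)
    ultimately show "\<exists>(P :: ('n \<Rightarrow> int) set) C d. finite P \<and> A \<subseteq> (\<Union>p\<in>P. C p) \<and> 0 \<le> d \<and> d \<le> \<delta> \<and>
        (\<forall>p\<in>P. bounded (C p) \<and> diameter (C p) \<le> d) \<and> real (card P) * d ^ k \<le> (6 * k * R) ^ k"
      using finP by blast
  qed
  also have "\<dots> < \<infinity>" by simp
  finally show ?thesis by (simp add: k_def)
qed

lemma sets_hausdorff_measure: "sets borel \<subseteq> sets (hausdorff_measure k)"
proof -
  have "sets borel \<subseteq> sets (measure_of UNIV (sets borel) (hausdorff_outer k))"
    by (auto simp: sets_measure_of_conv intro: sigma_sets.Basic)
  then show ?thesis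
    unfolding hausdorff_measure_def by (blast intro: sets_completionI_sets)
qed

text \<open>\<^const>\<open>measure_of\<close> agrees with the outer measure on Borel sets if that is countably additive
  there, and is the zero measure otherwise; the bound holds either way.\<close>

lemma emeasure_hausdorff_measure_le:
  assumes "A \<in> sets borel"
  shows "emeasure (hausdorff_measure k) A \<le> hausdorff_outer k A"
proof -
  have "emeasure (hausdorff_measure k) A = emeasure (measure_of UNIV (sets borel) (hausdorff_outer k)) A"
    unfolding hausdorff_measure_def using assms
    by (intro emeasure_completion[THEN trans] main_part[THEN arg_cong[where f = "emeasure _"]])
       (auto simp: sets_measure_of_conv)
  also have "\<dots> \<le> hausdorff_outer k A"
    by (simp add: emeasure_measure_of_conv)
  finally show ?thesis .
qed

lemma surr_bd_subset_Union: "finite \<S> \<Longrightarrow> surr_bd \<S> \<subseteq> (\<Union>T\<in>\<S>. frontier T)"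
  unfolding surr_bd_def surr_dom_def
  using frontier_interior_subset frontier_Union_subset by blast

lemma compact_surr_bd:
  assumes "finite \<S>" "\<And>T. T \<in> \<S> \<Longrightarrow> compact T"
  shows "compact (surr_bd \<S>)"
proof -
  have "bounded (\<Union>\<S>)" using assms by (intro compact_imp_bounded compact_Union)
  then have "bounded (surr_dom \<S>)"
    unfolding surr_dom_def using bounded_subset interior_subset by blast
  then show ?thesis
    unfolding surr_bd_def by (rule compact_frontier_bounded)
qed

lemma full_simplex_affine_hull:
  fixes T :: "(real ^ 'n) set"
  assumes "int CARD('n) simplex T"
  shows "affine hull T = UNIV"
  using aff_dim_simplex[OF assms] aff_dim_eq_full[of T] by simp

lemma full_simplex_interior:
  fixes T :: "(real ^ 'n) set"
  assumes "int CARD('n) simplex T"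
  shows "interior T \<noteq> {}"
proof -
  have "T \<noteq> {}" using full_simplex_affine_hull[OF assms] by auto
  moreover have "convex T" using assms by (auto simp: simplex_def)
  ultimately show ?thesis
    using rel_interior_eq_empty rel_interior_interior full_simplex_affine_hull[OF assms] by metis
qed

lemma full_simplex_diameter_pos:
  fixes T :: "(real ^ 'n) set"
  assumes "int CARD('n) simplex T"
  shows "0 < diameter T"
proof -
  obtain x r where r: "0 < r" "cball x r \<subseteq> T"
    using full_simplex_interior[OF assms] mem_interior_cball by blast
  have "compact T" using simplex_imp_polytope[OF assms] by (rule polytope_imp_compact)
  then have "dist x (x + r *\<^sub>R axis undefined 1) \<le> diameter T"
    using r by (intro diameter_bounded_bound compact_imp_bounded subsetD[OF r(2)])
      (auto simp: dist_norm)
  then show ?thesis using r by (simp add: dist_norm)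
qed

lemma surface_measure_surr_bd_finite:
  fixes \<S> :: "(real ^ 'n) set set"
  assumes n: "2 \<le> CARD('n)" and fin: "finite \<S>"
    and simp: "\<And>T. T \<in> \<S> \<Longrightarrow> int CARD('n) simplex T"
  shows "emeasure surface_measure (surr_bd \<S>) < \<infinity>"
proof -
  let ?m = "surface_measure :: (real ^ 'n) measure"
  have borel: "A \<in> sets ?m" if "A \<in> sets borel" for A
    using that sets_hausdorff_measure unfolding surface_measure_def by blast
  define \<F> where "\<F> = (\<Union>T\<in>\<S>. {F. F facet_of T})"
  have fin\<F>: "finite \<F>"
    using fin simp by (auto simp: \<F>_def intro: finite_polyhedron_facets simplex_imp_polyhedron)
  have "frontier T \<subseteq> \<Union>\<F>" if T: "T \<in> \<S>" for T
    using rel_frontier_of_polyhedron[OF simplex_imp_polyhedron[OF simp[OF T]]]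
      rel_frontier_frontier[OF full_simplex_affine_hull[OF simp[OF T]]] T
    by (auto simp: \<F>_def)
  then have sub: "surr_bd \<S> \<subseteq> \<Union>\<F>"
    using surr_bd_subset_Union[OF fin] by blast
  have F: "compact F \<and> emeasure ?m F < \<infinity>" if F: "F \<in> \<F>" for F
  proof -
    obtain T where T: "T \<in> \<S>" "F facet_of T" using F unfolding \<F>_def by blast
    have "polytope F"
      using T simp by (meson face_of_polytope_polytope facet_of_imp_face_of simplex_imp_polytope)
    then have cF: "compact F" by (rule polytope_imp_compact)
    have "aff_dim F = int CARD('n) - 1"
      using T simp[OF T(1)] by (simp add: facet_of_def aff_dim_simplex)
    then obtain a b where ab: "a \<noteq> 0" "affine hull F = {x. a \<bullet> x = b}"
      using aff_dim_eq_hyperplane[of F] by auto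
    have "emeasure ?m F \<le> hausdorff_outer (CARD('n) - 1) F"
      unfolding surface_measure_def using cF
      by (intro emeasure_hausdorff_measure_le borel_compact)
    also have "\<dots> < \<infinity>"
      using ab hull_subset[of F affine] cF
      by (intro hausdorff_outer_bounded_hyperplane[OF n]) (auto intro: compact_imp_bounded)
    finally show ?thesis using cF by blast
  qed
  have "emeasure ?m (surr_bd \<S>) \<le> emeasure ?m (\<Union>\<F>)"
    using F fin\<F> by (intro emeasure_mono[OF sub] borel) (auto intro: borel_compact)
  also have "\<dots> \<le> (\<Sum>F\<in>\<F>. emeasure ?m F)"
    using F fin\<F> emeasure_subadditive_finite[of \<F> "\<lambda>F. F" ?m] by (auto intro: borel borel_compact)
  also have "\<dots> < \<infinity>"
    using F fin\<F> by simp
  finally show ?thesis .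
qed

section \<open>Traces on the surrogate boundary are measurable and bounded\<close>

lemma P1_eqI:
  fixes p q :: "real ^ 'n \<Rightarrow> real"
  assumes "p \<in> P1" "q \<in> P1" "open U" "U \<noteq> {}" and eq: "\<And>x. x \<in> U \<Longrightarrow> p x = q x"
  shows "p = q"
proof -
  obtain a b where p: "p = (\<lambda>x. a + b \<bullet> x)" using assms(1) by (auto simp: P1_def)
  obtain a' b' where q: "q = (\<lambda>x. a' + b' \<bullet> x)" using assms(2) by (auto simp: P1_def)
  obtain c where c: "c \<in> U" using assms by blast
  then obtain r where r: "0 < r" "cball c r \<subseteq> U"
    using \<open>open U\<close> open_contains_cball by blast
  have "b = b'"
  proof (rule ccontr)
    assume ne: "b \<noteq> b'"
    define t where "t = r / norm (b - b')"
    have t0: "0 < t" using r ne by (simp add: t_def)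
    have "c + t *\<^sub>R (b - b') \<in> U"
      using r ne by (intro subsetD[OF r(2)]) (simp add: dist_norm t_def)
    from eq[OF this] eq[OF c] have "t * ((b - b') \<bullet> (b - b')) = 0"
      by (simp add: p q algebra_simps inner_commute)
    then show False using t0 ne by simp
  qed
  then show ?thesis using eq[OF c] by (simp add: p q)
qed

text \<open>An affine function is determined by its values on an open set, so the definite description
  in \<^const>\<open>piece\<close> denotes on elements with nonempty interior.\<close>

lemma piece_in_P1:
  assumes "v \<in> V \<S>" "T \<in> \<S>" and "interior T \<noteq> {}"
  shows "piece T v \<in> P1"
proof -
  obtain p where p: "p \<in> P1" "\<forall>x\<in>interior T. v x = p x"
    using assms unfolding V_def by blast
  have "\<exists>!q. q \<in> P1 \<and> (\<forall>x\<in>interior T. v x = q x)"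
  proof (rule ex1I[of _ p])
    show "q = p" if "q \<in> P1 \<and> (\<forall>x\<in>interior T. v x = q x)" for q
      using that p assms(3) by (intro P1_eqI[of q p "interior T"]) auto
  qed (use p in blast)
  from theI'[OF this] show ?thesis unfolding piece_def by blast
qed

lemma grad_affine: "grad (\<lambda>x. a + b \<bullet> x) y = b"
proof -
  have "GDERIV (\<lambda>x. a + b \<bullet> x) y :> b"
    unfolding gderiv_def by (auto intro!: derivative_eq_intros simp: inner_commute)
  moreover have "D = b" if "GDERIV (\<lambda>x. a + b \<bullet> x) y :> D" for D
  proof -
    have "(\<lambda>h. h \<bullet> D) = (\<lambda>h. h \<bullet> b)"
      using that \<open>GDERIV _ y :> b\<close> unfolding gderiv_def by (rule has_derivative_unique)
    then have "(D - b) \<bullet> D = (D - b) \<bullet> b" by meson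
    then have "(D - b) \<bullet> (D - b) = 0" by (simp add: inner_diff_right)
    then show "D = b" by simp
  qed
  ultimately show ?thesis unfolding grad_def by (intro the_equality)
qed

text \<open>On finite measure spaces this class consists of integrable functions, and unlike
  integrability it is stable under products; every boundary integrand is built within it.\<close>

definition bounded_measurable :: "'a measure \<Rightarrow> ('a \<Rightarrow> 'b::euclidean_space) \<Rightarrow> bool" where
  "bounded_measurable N f \<longleftrightarrow> f \<in> borel_measurable N \<and> (\<exists>B. \<forall>x\<in>space N. norm (f x) \<le> B)"

lemma bounded_measurable_add:
  assumes "bounded_measurable N f" "bounded_measurable N g"
  shows "bounded_measurable N (\<lambda>x. f x + g x)"
proof -
  obtain A B where "\<forall>x\<in>space N. norm (f x) \<le> A" "\<forall>x\<in>space N. norm (g x) \<le> B"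
    using assms by (auto simp: bounded_measurable_def)
  then have "\<forall>x\<in>space N. norm (f x + g x) \<le> A + B"
    by (blast intro: norm_add_rule_thm)
  then show ?thesis using assms by (auto simp: bounded_measurable_def)
qed

lemma bounded_measurable_inner:
  assumes "bounded_measurable N f" "bounded_measurable N g"
  shows "bounded_measurable N (\<lambda>x. f x \<bullet> g x)"
proof -
  obtain A B where A: "\<forall>x\<in>space N. norm (f x) \<le> A" and B: "\<forall>x\<in>space N. norm (g x) \<le> B"
    using assms by (auto simp: bounded_measurable_def)
  have "norm (f x \<bullet> g x) \<le> A * B" if x: "x \<in> space N" for x
  proof -
    have "norm (f x \<bullet> g x) \<le> norm (f x) * norm (g x)" by (simp add: Cauchy_Schwarz_ineq2)
    also have "\<dots> \<le> A * B"
      using A B x norm_ge_zero order_trans by (intro mult_mono) blast+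
    finally show ?thesis .
  qed
  then show ?thesis using assms by (auto simp: bounded_measurable_def)
qed

lemma bounded_measurable_mult:
  fixes f g :: "'a \<Rightarrow> real"
  assumes "bounded_measurable N f" "bounded_measurable N g"
  shows "bounded_measurable N (\<lambda>x. f x * g x)"
  using bounded_measurable_inner[OF assms] by simp

lemma bounded_measurable_integrable:
  assumes "emeasure N (space N) < \<infinity>" "bounded_measurable N f"
  shows "integrable N f"
proof -
  interpret finite_measure N using assms(1) by (intro finite_measureI) auto
  show ?thesis
    using assms(2) integrable_const_bound by (auto simp: bounded_measurable_def)
qed

definition bd_measure :: "(real ^ 'n) set set \<Rightarrow> (real ^ 'n) measure" where
  "bd_measure \<S> = restrict_space surface_measure (surr_bd \<S>)"

lemma space_bd_measure: "space (bd_measure \<S>) = surr_bd \<S>"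
  by (simp add: bd_measure_def space_restrict_space surface_measure_def hausdorff_measure_def
      space_measure_of_conv)

lemma surr_bd_sets: "surr_bd \<S> \<in> sets surface_measure"
proof -
  have "surr_bd \<S> \<in> sets borel" by (simp add: surr_bd_def)
  then show ?thesis
    using sets_hausdorff_measure unfolding surface_measure_def by blast
qed

lemma L2_inner_surr_bd:
  "L2_inner surface_measure (surr_bd \<S>) f g = (LINT x|bd_measure \<S>. f x \<bullet> g x)"
  unfolding L2_inner_def set_lebesgue_integral_def bd_measure_def
  by (subst integral_restrict_space) (auto simp: surr_bd_sets sets.sets_into_space)

lemma sets_bd_measure: "A \<in> sets borel \<Longrightarrow> surr_bd \<S> \<inter> A \<in> sets (bd_measure \<S>)"
  using sets_hausdorff_measure unfolding bd_measure_def surface_measure_def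
  by (auto simp: sets_restrict_space)

lemma borel_measurable_bd_measure:
  assumes "f \<in> borel_measurable borel"
  shows "f \<in> borel_measurable (bd_measure \<S>)"
proof (rule measurableI)
  fix A assume "A \<in> sets (borel :: 'b measure)"
  then have "f -` A \<in> sets borel" using assms measurable_sets[of f borel borel A] by simp
  then show "f -` A \<inter> space (bd_measure \<S>) \<in> sets (bd_measure \<S>)"
    using sets_bd_measure by (metis Int_commute space_bd_measure)
qed simp

lemma emeasure_bd_measure_finite:
  fixes \<S> :: "(real ^ 'n) set set"
  assumes "2 \<le> CARD('n)" "finite \<S>" "\<And>T. T \<in> \<S> \<Longrightarrow> int CARD('n) simplex T"
  shows "emeasure (bd_measure \<S>) (space (bd_measure \<S>)) < \<infinity>"
  unfolding space_bd_measure unfolding bd_measure_def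
  using surface_measure_surr_bd_finite[OF assms] surr_bd_sets
  by (subst emeasure_restrict_space) (auto simp: sets.sets_into_space)

lemma elem_at_mem:
  assumes "finite \<S>" "\<And>T. T \<in> \<S> \<Longrightarrow> closed T" "x \<in> surr_bd \<S>"
  shows "elem_at \<S> x \<in> \<S> \<and> x \<in> elem_at \<S> x"
proof -
  obtain T where "T \<in> \<S>" "x \<in> frontier T"
    using surr_bd_subset_Union assms by blast
  then have "T \<in> \<S> \<and> x \<in> T" using assms(2) frontier_subset_closed by blast
  then show ?thesis unfolding elem_at_def by (rule someI)
qed

text \<open>The element chosen at a point depends only on the set of elements that contain the point,
  and this set takes finitely many values, each of them on a Borel set.\<close>

lemma measurable_elem_at:
  assumes fin: "finite \<S>" and closed: "\<And>T. T \<in> \<S> \<Longrightarrow> closed T"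
  shows "elem_at \<S> \<in> bd_measure \<S> \<rightarrow>\<^sub>M count_space \<S>"
proof -
  have "(\<lambda>x. {T\<in>\<S>. x \<in> T}) \<in> bd_measure \<S> \<rightarrow>\<^sub>M count_space (Pow \<S>)"
  proof (rule measurable_count_space_eq2[THEN iffD2])
    show "finite (Pow \<S>)" using fin by simp
    have "(\<lambda>x. {T\<in>\<S>. x \<in> T}) -` {A} \<inter> space (bd_measure \<S>) \<in> sets (bd_measure \<S>)"
      if "A \<in> Pow \<S>" for A
    proof -
      have "{x. {T\<in>\<S>. x \<in> T} = A} = (\<Inter>T\<in>A. T) \<inter> (\<Inter>T\<in>\<S> - A. - T)"
        using that by auto
      also have "\<dots> \<in> sets borel"
      proof (rule sets.Int)
        show "(\<Inter>T\<in>A. T) \<in> sets borel"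
          using that closed by (intro borel_closed closed_INT) auto
        have "open (\<Inter>T\<in>\<S> - A. - T)"
          using fin closed by (intro open_INT) auto
        then show "(\<Inter>T\<in>\<S> - A. - T) \<in> sets borel" by simp
      qed
      finally have "surr_bd \<S> \<inter> {x. {T\<in>\<S>. x \<in> T} = A} \<in> sets (bd_measure \<S>)"
        by (rule sets_bd_measure)
      then show ?thesis by (simp add: space_bd_measure vimage_def Int_commute)
    qed
    then show "(\<lambda>x. {T\<in>\<S>. x \<in> T}) \<in> space (bd_measure \<S>) \<rightarrow> Pow \<S> \<and>
      (\<forall>A\<in>Pow \<S>. (\<lambda>x. {T\<in>\<S>. x \<in> T}) -` {A} \<inter> space (bd_measure \<S>) \<in> sets (bd_measure \<S>))"
      by auto
  qed
  then have "(\<lambda>x. SOME T. T \<in> {T\<in>\<S>. x \<in> T}) \<in> bd_measure \<S> \<rightarrow>\<^sub>M count_space UNIV"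
    by (rule measurable_compose) simp
  then have "elem_at \<S> \<in> bd_measure \<S> \<rightarrow>\<^sub>M count_space UNIV"
    by (simp add: elem_at_def[abs_def])
  moreover have "elem_at \<S> \<in> space (bd_measure \<S>) \<rightarrow> \<S>"
    using elem_at_mem[OF fin closed] by (auto simp: space_bd_measure)
  ultimately show ?thesis
    by (auto simp: measurable_def)
qed

lemma bounded_measurable_elementwise:
  assumes fin: "finite \<S>" and closed: "\<And>T. T \<in> \<S> \<Longrightarrow> closed T"
    and f: "\<And>T. T \<in> \<S> \<Longrightarrow> bounded_measurable (bd_measure \<S>) (f T)"
  shows "bounded_measurable (bd_measure \<S>) (\<lambda>x. f (elem_at \<S> x) x)"
proof -
  have "(\<lambda>x. f (elem_at \<S> x) x) \<in> borel_measurable (bd_measure \<S>)"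
  proof (rule measurable_compose_countable'[where I = \<S>])
    show "f T \<in> borel_measurable (bd_measure \<S>)" if "T \<in> \<S>" for T
      using f[OF that] by (simp add: bounded_measurable_def)
  qed (use fin closed in \<open>auto intro: measurable_elem_at countable_finite\<close>)
  moreover have "\<exists>B. \<forall>x\<in>surr_bd \<S>. norm (f (elem_at \<S> x) x) \<le> B"
  proof -
    have "\<forall>T\<in>\<S>. \<exists>B. \<forall>x\<in>surr_bd \<S>. norm (f T x) \<le> B"
      using f by (auto simp: bounded_measurable_def space_bd_measure)
    from bchoice[OF this] obtain B where B: "\<forall>T\<in>\<S>. \<forall>x\<in>surr_bd \<S>. norm (f T x) \<le> B T"
      by blast
    have "norm (f (elem_at \<S> x) x) \<le> (\<Sum>T\<in>\<S>. \<bar>B T\<bar>)" if x: "x \<in> surr_bd \<S>" for x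
    proof -
      have mem: "elem_at \<S> x \<in> \<S>" using elem_at_mem[OF fin closed x] by blast
      then have "norm (f (elem_at \<S> x) x) \<le> \<bar>B (elem_at \<S> x)\<bar>" using B x by force
      also have "\<dots> \<le> (\<Sum>T\<in>\<S>. \<bar>B T\<bar>)" using mem fin by (intro member_le_sum) auto
      finally show ?thesis .
    qed
    then show ?thesis by blast
  qed
  ultimately show ?thesis by (simp add: bounded_measurable_def space_bd_measure)
qed

lemma bounded_measurable_elem_const:
  fixes f :: "(real ^ 'n) set \<Rightarrow> 'b::euclidean_space"
  assumes "finite \<S>" "\<And>T. T \<in> \<S> \<Longrightarrow> closed T"
  shows "bounded_measurable (bd_measure \<S>) (\<lambda>x. f (elem_at \<S> x))"
  using assms
  by (intro bounded_measurable_elementwise[where f = "\<lambda>T _. f T"]) (auto simp: bounded_measurable_def)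

lemma piece_affine:
  fixes \<S> :: "(real ^ 'n) set set"
  assumes "v \<in> V \<S>" "T \<in> \<S>" "int CARD('n) simplex T"
  obtains a b where "piece T v = (\<lambda>x. a + b \<bullet> x)"
  using piece_in_P1[OF assms(1,2) full_simplex_interior[OF assms(3)]] by (auto simp: P1_def)

lemma bounded_measurable_tr:
  fixes \<S> :: "(real ^ 'n) set set"
  assumes fin: "finite \<S>" and simp: "\<And>T. T \<in> \<S> \<Longrightarrow> int CARD('n) simplex T" and v: "v \<in> V \<S>"
  shows "bounded_measurable (bd_measure \<S>) (tr \<S> v)"
    and "bounded_measurable (bd_measure \<S>) (tr_grad \<S> v)"
proof -
  have cpt: "compact T" if "T \<in> \<S>" for T
    using simp[OF that] simplex_imp_polytope polytope_imp_compact by blast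
  then have closed: "closed T" if "T \<in> \<S>" for T using that compact_imp_closed by blast
  have p: "bounded_measurable (bd_measure \<S>) (piece T v)"
    "bounded_measurable (bd_measure \<S>) (grad (piece T v))" if T: "T \<in> \<S>" for T
  proof -
    obtain a b where ab: "piece T v = (\<lambda>x. a + b \<bullet> x)"
      using piece_affine[OF v T simp[OF T]] .
    have "compact ((\<lambda>x. a + b \<bullet> x) ` surr_bd \<S>)"
      using fin cpt by (intro compact_continuous_image continuous_intros compact_surr_bd)
    then obtain B where "\<forall>x\<in>surr_bd \<S>. norm (a + b \<bullet> x) \<le> B"
      using compact_imp_bounded bounded_iff by (metis image_eqI)
    then show "bounded_measurable (bd_measure \<S>) (piece T v)"
      by (auto simp: ab bounded_measurable_def space_bd_measure intro!: borel_measurable_bd_measure)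
    have "grad (piece T v) = (\<lambda>_. b)" by (simp add: ab grad_affine fun_eq_iff)
    then show "bounded_measurable (bd_measure \<S>) (grad (piece T v))"
      by (auto simp: bounded_measurable_def)
  qed
  show "bounded_measurable (bd_measure \<S>) (tr \<S> v)"
    unfolding tr_def[abs_def]
    by (rule bounded_measurable_elementwise[where f = "\<lambda>T. piece T v", OF fin closed p(1)])
  show "bounded_measurable (bd_measure \<S>) (tr_grad \<S> v)"
    unfolding tr_grad_def[abs_def]
    by (rule bounded_measurable_elementwise[where f = "\<lambda>T. grad (piece T v)", OF fin closed p(2)])
qed

lemma flat_normal_unique:
  assumes "is_flat_normal U x \<nu>" "is_flat_normal U x \<mu>"
  shows "\<nu> = \<mu>"
proof (rule ccontr)
  assume ne: "\<nu> \<noteq> \<mu>"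
  obtain r s where n: "norm \<nu> = 1" "norm \<mu> = 1" and r: "0 < r" "0 < s"
    and U: "\<And>y. y \<in> ball x r \<Longrightarrow> y \<in> U \<longleftrightarrow> (y - x) \<bullet> \<nu> < 0"
      "\<And>y. y \<in> ball x s \<Longrightarrow> y \<in> U \<longleftrightarrow> (y - x) \<bullet> \<mu> < 0"
    using assms by (auto simp: is_flat_normal_def)
  have "0 < (\<mu> - \<nu>) \<bullet> (\<mu> - \<nu>)" using ne by simp
  then have lt: "\<mu> \<bullet> \<nu> < 1"
    using n by (simp add: norm_eq_1 inner_diff_left inner_diff_right inner_commute[of \<nu> \<mu>])
  define t where "t = min r s / (2 * norm (\<mu> - \<nu>))"
  have t0: "0 < t" using r ne by (simp add: t_def)
  \<comment> \<open>The direction \<open>\<mu> - \<nu>\<close> points into one half space and out of the other.\<close>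
  define y where "y = x + t *\<^sub>R (\<mu> - \<nu>)"
  have "dist x y = min r s / 2" using ne r by (simp add: y_def dist_norm t_def)
  then have "y \<in> ball x r" "y \<in> ball x s" using r by auto
  moreover have "(y - x) \<bullet> \<nu> = t * (\<mu> \<bullet> \<nu> - 1)" "(y - x) \<bullet> \<mu> = t * (1 - \<mu> \<bullet> \<nu>)"
    using n by (simp_all add: y_def norm_eq_1 inner_diff_left inner_commute[of \<nu> \<mu>])
  ultimately show False
    using U(1)[of y] U(2)[of y] t0 lt by (auto simp: mult_less_0_iff)
qed

lemma outward_normal_eq: "is_flat_normal U x \<nu> \<Longrightarrow> outward_normal U x = \<nu>"
  unfolding outward_normal_def using flat_normal_unique by (metis the_equality)

lemma norm_outward_normal_le: "norm (outward_normal U x) \<le> 1"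
proof (cases "\<exists>\<nu>. is_flat_normal U x \<nu>")
  case True
  then obtain \<nu> where "is_flat_normal U x \<nu>" by blast
  then show ?thesis using outward_normal_eq[of U x \<nu>] by (simp add: is_flat_normal_def)
qed (simp add: outward_normal_def)

text \<open>If \<open>U\<close> is a half space near \<open>x\<close>, then it is the same half space near every boundary point
  close to \<open>x\<close>.  So the points with a normal form a relatively open part of the boundary, on which
  the normal is locally constant; this makes it a Borel function.\<close>

lemma flat_normal_nearby:
  assumes "is_flat_normal U x \<nu>"
  obtains r where "0 < r" "\<And>y. y \<in> ball x r \<Longrightarrow> y \<in> frontier U \<Longrightarrow> is_flat_normal U y \<nu>"
proof -
  obtain r where n: "norm \<nu> = 1" and r: "0 < r"
    and U: "\<And>y. y \<in> ball x r \<Longrightarrow> y \<in> U \<longleftrightarrow> (y - x) \<bullet> \<nu> < 0"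
    using assms by (auto simp: is_flat_normal_def)
  have "is_flat_normal U y \<nu>" if y: "y \<in> ball x r" "y \<in> frontier U" for y
  proof -
    have "(y - x) \<bullet> \<nu> = 0"
    proof (rule ccontr)
      assume ne: "(y - x) \<bullet> \<nu> \<noteq> 0"
      define W where "W = ball x r \<inter> {z. 0 < ((z - x) \<bullet> \<nu>) * ((y - x) \<bullet> \<nu>)}"
      have "open {z. 0 < ((z - x) \<bullet> \<nu>) * ((y - x) \<bullet> \<nu>)}"
        by (intro open_Collect_less continuous_intros)
      then have W: "open W" "y \<in> W" using y ne by (auto simp: W_def zero_less_mult_iff)
      moreover have "z \<in> U \<longleftrightarrow> y \<in> U" if "z \<in> W" for z
        using U y that by (auto simp: W_def zero_less_mult_iff)
      ultimately have "W \<subseteq> U \<or> W \<inter> closure U = {}"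
        using open_Int_closure_eq_empty by blast
      then have "y \<in> interior U \<or> y \<notin> closure U" using W interior_maximal by blast
      then show False using y by (simp add: frontier_def)
    qed
    then have shift: "(z - x) \<bullet> \<nu> = (z - y) \<bullet> \<nu>" for z by (simp add: inner_diff_left)
    have "z \<in> U \<longleftrightarrow> (z - y) \<bullet> \<nu> < 0" if "z \<in> ball y (r - dist x y)" for z
    proof -
      have "dist x z < r" using that dist_triangle[of x z y] by simp
      then show ?thesis using U[of z] shift[of z] by simp
    qed
    then show ?thesis using n y unfolding is_flat_normal_def by (intro conjI exI[of _ "r - dist x y"]) auto
  qed
  then show ?thesis using that r by blast
qed

lemma borel_measurable_outward_normal:
  "outward_normal U \<in> borel_measurable (restrict_space borel (frontier U))"
proof -
  define F where "F = {x \<in> frontier U. \<exists>\<nu>. is_flat_normal U x \<nu>}"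
  have near: "\<exists>r>0. \<forall>y\<in>ball x r \<inter> frontier U. y \<in> F \<and> outward_normal U y = outward_normal U x"
    if x: "x \<in> F" for x
  proof -
    obtain \<nu> where \<nu>: "is_flat_normal U x \<nu>" using x by (auto simp: F_def)
    obtain r where "0 < r" "\<And>y. y \<in> ball x r \<Longrightarrow> y \<in> frontier U \<Longrightarrow> is_flat_normal U y \<nu>"
      using flat_normal_nearby[OF \<nu>] by blast
    then have "y \<in> F \<and> outward_normal U y = outward_normal U x" if "y \<in> ball x r \<inter> frontier U" for y
      using outward_normal_eq[OF \<nu>] outward_normal_eq[of U y \<nu>] that unfolding F_def by blast
    then show ?thesis using \<open>0 < r\<close> by blast
  qed
  have "openin (top_of_set (frontier U)) F"
    unfolding openin_contains_ball
  proof (intro conjI ballI)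
    show "\<exists>e>0. ball x e \<inter> frontier U \<subseteq> F" if "x \<in> F" for x
      using near[OF that] by blast
  qed (auto simp: F_def)
  then obtain W where "open W" "F = frontier U \<inter> W" by (auto simp: openin_open)
  then have F: "F \<in> sets borel" by auto
  have cont: "continuous_on F (outward_normal U)"
  proof (rule continuous_on_eq_continuous_within[THEN iffD2], rule ballI)
    fix x assume "x \<in> F"
    then obtain r where r: "0 < r" "\<forall>y\<in>ball x r \<inter> frontier U. outward_normal U y = outward_normal U x"
      using near by blast
    have "\<forall>\<^sub>F y in at x within F. outward_normal U y = outward_normal U x"
      unfolding eventually_at using r by (intro exI[of _ r]) (auto simp: F_def dist_commute)
    then show "continuous (at x within F) (outward_normal U)"
      unfolding continuous_within by (rule tendsto_eventually)
  qed
  have "(\<lambda>x. if x \<in> F then outward_normal U x else 0) \<in> borel_measurable borel"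
    using F cont by (intro borel_measurable_continuous_on_if) auto
  then have "(\<lambda>x. if x \<in> F then outward_normal U x else 0) \<in> borel_measurable (restrict_space borel (frontier U))"
    by (rule measurable_restrict_space1)
  then show ?thesis
    by (rule measurable_cong[THEN iffD1, rotated]) (auto simp: F_def outward_normal_def space_restrict_space)
qed

lemma bounded_measurable_outward_normal:
  "bounded_measurable (bd_measure \<S>) (outward_normal (surr_dom \<S>))"
proof -
  have "outward_normal (surr_dom \<S>) \<in> borel_measurable (bd_measure \<S>)"
  proof (rule measurableI)
    fix A :: "(real ^ 'a) set" assume A: "A \<in> sets borel"
    have "outward_normal (surr_dom \<S>) -` A \<inter> surr_bd \<S> \<in> sets (restrict_space borel (surr_bd \<S>))"
      using measurable_sets[OF borel_measurable_outward_normal A]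
      by (simp add: surr_bd_def space_restrict_space)
    then obtain B where "B \<in> sets borel" "outward_normal (surr_dom \<S>) -` A \<inter> surr_bd \<S> = surr_bd \<S> \<inter> B"
      by (auto simp: sets_restrict_space)
    then show "outward_normal (surr_dom \<S>) -` A \<inter> space (bd_measure \<S>) \<in> sets (bd_measure \<S>)"
      using sets_bd_measure by (simp add: space_bd_measure)
  qed simp
  then show ?thesis
    using norm_outward_normal_le by (auto simp: bounded_measurable_def)
qed

section \<open>Coercivity\<close>

lemma L2_inner_self_nonneg: "0 \<le> L2_inner N A f f"
  unfolding L2_inner_def set_lebesgue_integral_def
  by (intro integral_nonneg_AE) (auto simp: indicator_def)

lemma L2_norm_squared: "(L2_norm N A f)\<^sup>2 = L2_inner N A f f"
  by (simp add: L2_norm_def L2_inner_self_nonneg)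

lemma two_mult_le_weighted_squares:
  fixes s \<eta> H C :: real
  assumes "0 < H" "0 < C"
  shows "2 * s * \<eta> \<le> 2 * C * (inverse H * s\<^sup>2) + H * \<eta>\<^sup>2 / (2 * C)"
proof -
  have "0 \<le> (2 * C * s - H * \<eta>)\<^sup>2 / (2 * C * H)" using assms by simp
  also have "\<dots> = 2 * C * (inverse H * s\<^sup>2) + H * \<eta>\<^sup>2 / (2 * C) - 2 * s * \<eta>"
    using assms by (simp add: field_simps power2_eq_square)
  finally show ?thesis by simp
qed

text \<open>This is the boundary integrand of \<open>a\<^sub>h(v,v)\<close>, with \<open>s\<close> for \<open>S\<^sub>h v\<close>, \<open>g\<close> for the gradient, and
  \<open>s - g \<bullet> d\<close> for \<open>v\<close>.  The cross term \<open>2 s (\<nu> \<bullet> g)\<close> costs \<open>H |g|\<^sup>2 / (2C)\<close> and the shift term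
  \<open>(\<nu> \<bullet> g) (g \<bullet> d)\<close> costs \<open>H |g|\<^sup>2 / (4C)\<close>; after the trace inequality these take one half and one
  quarter of the volume term.\<close>

lemma boundary_integrand_lower_bound:
  fixes g d \<nu> :: "'a::real_inner" and s H C :: real
  assumes H: "0 < H" and C: "0 < C" and \<nu>: "norm \<nu> \<le> 1" and d: "norm d \<le> H / (4 * C)"
  shows "(\<gamma> - 2 * C) * (inverse H * s\<^sup>2) - 3 / (4 * C) * (H * (g \<bullet> g))
    \<le> \<gamma> * (inverse H * s * s) - (\<nu> \<bullet> g) * (s - g \<bullet> d) - s * (\<nu> \<bullet> g)"
proof -
  have "\<bar>\<nu> \<bullet> g\<bar> \<le> norm \<nu> * norm g" by (rule Cauchy_Schwarz_ineq2)
  also have "\<dots> \<le> norm g" using \<nu> by (simp add: mult_left_le_one_le)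
  finally have \<eta>: "\<bar>\<nu> \<bullet> g\<bar> \<le> norm g" .
  then have "(\<nu> \<bullet> g)\<^sup>2 \<le> (norm g)\<^sup>2" by (metis abs_ge_zero power2_abs power_mono)
  then have "H * (\<nu> \<bullet> g)\<^sup>2 / (2 * C) \<le> H * (g \<bullet> g) / (2 * C)"
    using H C by (intro divide_right_mono mult_left_mono) (auto simp: power2_norm_eq_inner)
  then have cross: "2 * s * (\<nu> \<bullet> g) \<le> 2 * C * (inverse H * s\<^sup>2) + H * (g \<bullet> g) / (2 * C)"
    using two_mult_le_weighted_squares[OF H C, of s "\<nu> \<bullet> g"] by linarith
  have "\<bar>(\<nu> \<bullet> g) * (g \<bullet> d)\<bar> \<le> norm g * (norm g * (H / (4 * C)))"
    unfolding abs_mult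
  proof (rule mult_mono[OF \<eta>])
    have "\<bar>g \<bullet> d\<bar> \<le> norm g * norm d" by (rule Cauchy_Schwarz_ineq2)
    also have "\<dots> \<le> norm g * (H / (4 * C))" using d by (rule mult_left_mono) simp
    finally show "\<bar>g \<bullet> d\<bar> \<le> norm g * (H / (4 * C))" .
  qed auto
  also have "\<dots> = H * (g \<bullet> g) / (4 * C)"
    by (simp add: power2_norm_eq_inner[symmetric] power2_eq_square)
  finally have shift: "- ((\<nu> \<bullet> g) * (g \<bullet> d)) \<le> H * (g \<bullet> g) / (4 * C)" by linarith
  have "H * (g \<bullet> g) / (2 * C) + H * (g \<bullet> g) / (4 * C) = 3 / (4 * C) * (H * (g \<bullet> g))"
    using C by (simp add: field_simps)
  then show ?thesis
    using cross shift by (simp add: algebra_simps power2_eq_square)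
qed

text \<open>The factor \<open>h\<^sub>T\<^sup>\<zeta>\<close> of the standing assumption is absorbed by the smallness of \<open>h\<^sub>\<Gamma>\<^sup>\<zeta>\<close>; the power
  \<open>h\<^sub>T\<close> that remains is the weight of the trace inequality.\<close>

lemma dist_vec_le_local_size:
  assumes fin: "finite \<S>" and mem: "T \<in> \<S>" "x \<in> T" "x \<in> surr_bd \<S>" and T: "0 < diameter T"
    and c: "0 < c" and \<zeta>: "0 \<le> \<zeta>" and C: "0 < C"
    and dist: "norm (dist_vec M x) \<le> c * diameter T powr (1 + \<zeta>)"
    and small: "h_bd \<S> powr \<zeta> \<le> 1 / (4 * c * C)"
  shows "norm (dist_vec M x) \<le> diameter T / (4 * C)"
proof -
  have "diameter T \<le> h_bd \<S>"
    unfolding h_bd_def using fin mem by (intro Max_ge) auto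
  then have "diameter T powr \<zeta> \<le> h_bd \<S> powr \<zeta>"
    using T \<zeta> by (intro powr_mono2) auto
  then have "diameter T powr \<zeta> \<le> 1 / (4 * c * C)" using small by linarith
  then have "c * (diameter T * diameter T powr \<zeta>) \<le> c * (diameter T * (1 / (4 * c * C)))"
    using T c by (intro mult_left_mono) auto
  also have "\<dots> = diameter T / (4 * C)" using c by (simp add: field_simps)
  finally show ?thesis using dist T by (simp add: powr_add)
qed

text \<open>The constant is explicit and contains nothing of the mesh, which is how \<open>\<alpha>\<close> can precede the
  mesh in the final statement.  The volume term is one nonnegative number \<open>G\<close> throughout, so
  integrability is a question about the boundary integrals alone.\<close>

lemma a_form_coercive:
  fixes \<S> :: "(real ^ 'n) set set" and M :: "real ^ 'n \<Rightarrow> real ^ 'n"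
  assumes n: "2 \<le> CARD('n)" and fin: "finite \<S>"
    and simp: "\<And>T. T \<in> \<S> \<Longrightarrow> int CARD('n) simplex T"
    and M: "M \<in> borel_measurable (restrict_space surface_measure (surr_bd \<S>))"
    and c: "0 < c" and \<zeta>: "0 \<le> \<zeta>" and C: "0 < C"
    and dist: "\<And>T x. \<lbrakk>T \<in> \<S>; x \<in> T \<inter> surr_bd \<S>\<rbrakk> \<Longrightarrow> norm (dist_vec M x) \<le> c * diameter T powr (1 + \<zeta>)"
    and trace: "mesh_trace_ineq C \<S>"
    and small: "h_bd \<S> powr \<zeta> \<le> 1 / (4 * c * C)"
    and v: "v \<in> V \<S>"
  shows "min (1 / 4) (\<gamma> - 2 * C) * (a_norm \<S> M v)\<^sup>2 \<le> a_form \<S> M \<gamma> v v"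
proof -
  define N where "N = bd_measure \<S>"
  define G where "G = L2_inner lebesgue (surr_dom \<S>) (wgrad (surr_dom \<S>) v) (wgrad (surr_dom \<S>) v)"
  let ?s = "shift \<S> M v" and ?g = "tr_grad \<S> v" and ?\<tau> = "tr \<S> v" and ?H = "h_at \<S>"
    and ?\<eta> = "normal_deriv \<S> v"
  have closed: "closed T" if "T \<in> \<S>" for T
    using simp[OF that] simplex_imp_polytope polytope_imp_closed by blast
  have elem: "elem_at \<S> x \<in> \<S>" "x \<in> elem_at \<S> x" if "x \<in> surr_bd \<S>" for x
    using elem_at_mem[OF fin closed that] by auto
  have spN: "space N = surr_bd \<S>" by (simp add: N_def space_bd_measure)
  have H0: "0 < ?H x" if "x \<in> surr_bd \<S>" for x
    using full_simplex_diameter_pos[OF simp[OF elem(1)[OF that]]] by (simp add: h_at_def)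
  have dH: "norm (dist_vec M x) \<le> ?H x / (4 * C)" if x: "x \<in> surr_bd \<S>" for x
    unfolding h_at_def using elem[OF x] x H0[OF x] c \<zeta> C small dist
    by (intro dist_vec_le_local_size[OF fin]) (auto simp: h_at_def)

  have const: "bounded_measurable N (\<lambda>x. f (elem_at \<S> x))" for f :: "(real ^ 'n) set \<Rightarrow> real"
    unfolding N_def by (rule bounded_measurable_elem_const[OF fin closed])
  have bH: "bounded_measurable N ?H" and biH: "bounded_measurable N (\<lambda>x. inverse (?H x))"
    using const[of diameter] const[of "\<lambda>T. inverse (diameter T)"] by (simp_all add: h_at_def[abs_def])
  have b\<tau>: "bounded_measurable N ?\<tau>" and bg: "bounded_measurable N ?g"
    unfolding N_def using bounded_measurable_tr[OF fin simp v] by auto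
  have b\<eta>: "bounded_measurable N ?\<eta>"
    unfolding normal_deriv_def[abs_def] N_def
    by (intro bounded_measurable_inner bounded_measurable_outward_normal bg[unfolded N_def])
  have "M \<in> borel_measurable N" using M by (simp add: N_def bd_measure_def)
  moreover have "(\<lambda>x. x) \<in> borel_measurable N"
    unfolding N_def by (rule borel_measurable_bd_measure) (rule measurable_ident_sets[OF refl])
  ultimately have "dist_vec M \<in> borel_measurable N"
    unfolding dist_vec_def[abs_def] by (rule borel_measurable_diff)
  moreover have "\<exists>B. \<forall>x\<in>space N. norm (dist_vec M x) \<le> B"
  proof -
    obtain B where "\<forall>x\<in>space N. norm (?H x) \<le> B" using bH by (auto simp: bounded_measurable_def)
    then have "\<forall>x\<in>space N. norm (dist_vec M x) \<le> B / (4 * C)"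
      using dH C unfolding spN by (force intro: order_trans divide_right_mono)
    then show ?thesis by blast
  qed
  ultimately have bd: "bounded_measurable N (dist_vec M)" by (simp add: bounded_measurable_def)
  have bs: "bounded_measurable N ?s"
    unfolding shift_def[abs_def] by (intro bounded_measurable_add b\<tau> bounded_measurable_inner bg bd)
  have int: "integrable N f" if "bounded_measurable N f" for f :: "_ \<Rightarrow> real"
    using bounded_measurable_integrable[OF _ that] emeasure_bd_measure_finite[OF n fin simp]
    by (simp add: N_def)
  have i1: "integrable N (\<lambda>x. ?\<eta> x * ?\<tau> x)" and i2: "integrable N (\<lambda>x. ?s x * ?\<eta> x)"
    and i3: "integrable N (\<lambda>x. inverse (?H x) * ?s x * ?s x)"
    and i4: "integrable N (\<lambda>x. ?H x * (?g x \<bullet> ?g x))"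
    and i5: "integrable N (\<lambda>x. inverse (?H x) * (?s x)\<^sup>2)"
    unfolding power2_eq_square
    by (intro int bounded_measurable_mult bounded_measurable_inner b\<tau> bg b\<eta> bs bH biH)+

  define B where "B = (LINT x|N. inverse (?H x) * (?s x)\<^sup>2)"
  define W where "W = (LINT x|N. ?H x * (?g x \<bullet> ?g x))"
  have form: "a_form \<S> M \<gamma> v v =
      G - (LINT x|N. ?\<eta> x * ?\<tau> x) - (LINT x|N. ?s x * ?\<eta> x) + \<gamma> * (LINT x|N. inverse (?H x) * ?s x * ?s x)"
    by (simp add: a_form_def G_def L2_inner_surr_bd N_def)
  have normB: "(L2_norm surface_measure (surr_bd \<S>) (\<lambda>x. ?H x powr (- 1 / 2) * ?s x))\<^sup>2 = B"
    unfolding L2_norm_squared L2_inner_surr_bd B_def N_def[symmetric]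
  proof (rule Bochner_Integration.integral_cong[OF refl])
    fix x assume "x \<in> space N"
    then have "?H x powr (- 1 / 2) * ?H x powr (- 1 / 2) = inverse (?H x)"
      using H0[of x] powr_add[of "?H x" "- 1 / 2" "- 1 / 2"] powr_neg_one[of "?H x"]
      by (simp add: spN inverse_eq_divide)
    then show "(?H x powr (- 1 / 2) * ?s x) \<bullet> (?H x powr (- 1 / 2) * ?s x) = inverse (?H x) * (?s x)\<^sup>2"
      by (simp add: power2_eq_square algebra_simps)
  qed
  have "(a_norm \<S> M v)\<^sup>2 = (L2_norm lebesgue (surr_dom \<S>) (wgrad (surr_dom \<S>) v))\<^sup>2 +
      (L2_norm surface_measure (surr_bd \<S>) (\<lambda>x. ?H x powr (- 1 / 2) * ?s x))\<^sup>2"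
    unfolding a_norm_def by (rule real_sqrt_pow2) simp
  then have norm: "(a_norm \<S> M v)\<^sup>2 = G + B"
    unfolding normB by (simp add: G_def L2_norm_squared)
  have "(L2_norm surface_measure (surr_bd \<S>) (\<lambda>x. ?H x powr (1 / 2) *\<^sub>R ?g x))\<^sup>2 = W"
    unfolding L2_norm_squared L2_inner_surr_bd W_def N_def[symmetric]
  proof (rule Bochner_Integration.integral_cong[OF refl])
    fix x assume "x \<in> space N"
    then have "?H x powr (1 / 2) * ?H x powr (1 / 2) = ?H x"
      using H0[of x] spN by (simp flip: powr_add)
    then show "(?H x powr (1 / 2) *\<^sub>R ?g x) \<bullet> (?H x powr (1 / 2) *\<^sub>R ?g x) = ?H x * (?g x \<bullet> ?g x)"
      by (simp flip: mult.assoc)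
  qed
  then have W: "W \<le> C * G"
    using trace v by (auto simp: mesh_trace_ineq_def L2_norm_squared[of lebesgue] G_def)

  have "(\<gamma> - 2 * C) * B - 3 / (4 * C) * W =
      (LINT x|N. (\<gamma> - 2 * C) * (inverse (?H x) * (?s x)\<^sup>2) - 3 / (4 * C) * (?H x * (?g x \<bullet> ?g x)))"
    using i4 i5 by (simp add: B_def W_def)
  also have "\<dots> \<le> (LINT x|N. \<gamma> * (inverse (?H x) * ?s x * ?s x) - ?\<eta> x * ?\<tau> x - ?s x * ?\<eta> x)"
  proof (rule integral_mono)
    fix x assume "x \<in> space N"
    then have x: "x \<in> surr_bd \<S>" by (simp add: spN)
    have "?\<tau> x = ?s x - ?g x \<bullet> dist_vec M x" by (simp add: shift_def)
    then show "(\<gamma> - 2 * C) * (inverse (?H x) * (?s x)\<^sup>2) - 3 / (4 * C) * (?H x * (?g x \<bullet> ?g x))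
        \<le> \<gamma> * (inverse (?H x) * ?s x * ?s x) - ?\<eta> x * ?\<tau> x - ?s x * ?\<eta> x"
      using boundary_integrand_lower_bound[OF H0[OF x] C norm_outward_normal_le dH[OF x]]
      by (simp add: normal_deriv_def)
  qed (use i1 i2 i3 i4 i5 in auto)
  also have "\<dots> = a_form \<S> M \<gamma> v v - G"
    using i1 i2 i3 by (simp add: form)
  finally have "G + (\<gamma> - 2 * C) * B - 3 / (4 * C) * W \<le> a_form \<S> M \<gamma> v v" by simp
  moreover have "3 / (4 * C) * W \<le> 3 / 4 * G"
    using mult_left_mono[OF W, of "3 / (4 * C)"] C by simp
  ultimately have lower: "1 / 4 * G + (\<gamma> - 2 * C) * B \<le> a_form \<S> M \<gamma> v v" by linarith
  have "0 \<le> G" by (simp add: G_def L2_inner_self_nonneg)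
  moreover have "0 \<le> B"
    unfolding B_def using H0 by (intro integral_nonneg_AE) (auto simp: spN less_imp_le)
  ultimately have "min (1 / 4) (\<gamma> - 2 * C) * G + min (1 / 4) (\<gamma> - 2 * C) * B
      \<le> 1 / 4 * G + (\<gamma> - 2 * C) * B"
    by (intro add_mono mult_right_mono min.cobounded1 min.cobounded2)
  then show ?thesis using lower by (simp add: norm distrib_left)
qed

theorem proposition1:
  fixes \<Omega> D :: "(real ^ 'n) set"
    and \<T> :: "'h \<Rightarrow> (real ^ 'n) set set"
    and M :: "'h \<Rightarrow> real ^ 'n \<Rightarrow> real ^ 'n"
    and c_d \<zeta> C_I \<gamma> k K :: real
  assumes dim: "CARD('n) = 2 \<or> CARD('n) = 3"
    and "open \<Omega>" "connected \<Omega>" "bounded \<Omega>" "\<Omega> \<noteq> {}"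
    and "lipschitz_boundary \<Omega>" "piecewise_C2 (frontier \<Omega>)"
    and "0 < k" "k \<le> diameter \<Omega>" "diameter \<Omega> \<le> K"
    and "\<exists>U. open U \<and> connected U \<and> D = closure U" "closure \<Omega> \<subseteq> D"
    and "\<And>h. mesh_of (\<T> h) D" "shape_regular \<T>"
    and "\<And>h x. x \<in> surr_bd (inner_elems \<Omega> (\<T> h)) \<Longrightarrow> M h x \<in> frontier \<Omega>"
    and "\<And>h. M h \<in> borel_measurable
                (restrict_space surface_measure (surr_bd (inner_elems \<Omega> (\<T> h))))"
    and "c_d > 0" "\<zeta> > 0"
    and "\<And>h T x. \<lbrakk>T \<in> inner_elems \<Omega> (\<T> h); x \<in> T \<inter> surr_bd (inner_elems \<Omega> (\<T> h))\<rbrakk>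
           \<Longrightarrow> norm (dist_vec (M h) x) \<le> c_d * diameter T powr (1 + \<zeta>)"
    and "C_I > 0"
    and "\<And>h T. T \<in> inner_elems \<Omega> (\<T> h) \<Longrightarrow> elem_trace_ineq C_I T"
    and "\<And>h. mesh_trace_ineq C_I (inner_elems \<Omega> (\<T> h))"
    and "\<gamma> > 0" "\<gamma> > 2 * C_I"
  shows "\<exists>\<alpha>>0. \<forall>h. h_bd (inner_elems \<Omega> (\<T> h)) powr \<zeta> \<le> 1 / (4 * c_d * C_I) \<longrightarrow>
           (\<forall>v\<in>V (inner_elems \<Omega> (\<T> h)).
              a_form (inner_elems \<Omega> (\<T> h)) (M h) \<gamma> v v
                \<ge> \<alpha> * (a_norm (inner_elems \<Omega> (\<T> h)) (M h) v)\<^sup>2)"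
proof (intro exI conjI allI impI ballI)
  show "0 < min (1 / 4) (\<gamma> - 2 * C_I)" using assms(24) by simp
  fix h v
  let ?S = "inner_elems \<Omega> (\<T> h)"
  assume small: "h_bd ?S powr \<zeta> \<le> 1 / (4 * c_d * C_I)" and v: "v \<in> V ?S"
  have mesh: "finite (\<T> h)" "\<And>T. T \<in> \<T> h \<Longrightarrow> int CARD('n) simplex T"
    using assms(13)[of h] by (auto simp: mesh_of_def triangulation_def)
  show "min (1 / 4) (\<gamma> - 2 * C_I) * (a_norm ?S (M h) v)\<^sup>2 \<le> a_form ?S (M h) \<gamma> v v"
  proof (rule a_form_coercive[where c = c_d and \<zeta> = \<zeta>])
    show "finite ?S" using mesh(1) by (simp add: inner_elems_def)
    show "int CARD('n) simplex T" if "T \<in> ?S" for T using that mesh(2) by (simp add: inner_elems_def)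
    show "norm (dist_vec (M h) x) \<le> c_d * diameter T powr (1 + \<zeta>)"
      if "T \<in> ?S" "x \<in> T \<inter> surr_bd ?S" for T x
      using assms(19)[OF that] .
    show "0 \<le> \<zeta>" using assms(18) by simp
  qed (use dim assms(16,17,20,22) small v in auto)
qed

end
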